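(* Let $R$ be a separative exchange ring in which $2$ is invertible, and let $a\in R$ be such that $a-a^3$ is regular in $R$. If $R(1-a^2)R=Rr(a)=\ell(a)R$, then $a$ is unit-regular.
   Context: All rings are associative with identity; modules are right modules. An element $x\in R$ is regular if $x=xyx$ for some $y\in R$, and unit-regular if $x=xux$ for some unit $u\in R$. $R$ is an exchange ring if for every $x\in R$ there is an idempotent $e\in xR$ with $1-e\in(1-x)R$. $R$ is separative if for all finitely generated projective right $R$-modules $A,B$: $A\oplus A\cong A\oplus B\cong B\oplus B$ implies $A\cong B$. For $a\in R$, $r(a)=\{x\in R: ax=0\}$ and $\ell(a)=\{x\in R: xa=0\}$; $Rr(a)$ and $\ell(a)R$ denote the (two-sided) ideals generated by these sets (sums of products), and $R(1-a^2)R$ the two-sided ideal generated by $1-a^2$. *)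

theory Defs
  imports Main
begin

definition ring_unit :: "'a::ring_1 \<Rightarrow> bool" where
  "ring_unit u \<longleftrightarrow> (\<exists>v. u * v = 1 \<and> v * u = 1)"

definition regular :: "'a::ring_1 \<Rightarrow> bool" where
  "regular x \<longleftrightarrow> (\<exists>y. x = x * y * x)"

definition unit_regular :: "'a::ring_1 \<Rightarrow> bool" where
  "unit_regular x \<longleftrightarrow> (\<exists>u. ring_unit u \<and> x = x * u * x)"

definition exchange_ring :: "'a::ring_1 itself \<Rightarrow> bool" where
  "exchange_ring _ \<longleftrightarrow>
     (\<forall>x::'a. \<exists>e. e * e = e \<and> (\<exists>r. e = x * r) \<and> (\<exists>s. 1 - e = (1 - x) * s))"

definition right_ann :: "'a::ring_1 \<Rightarrow> 'a set" where
  "right_ann a = {x. a * x = 0}"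

definition left_ann :: "'a::ring_1 \<Rightarrow> 'a set" where
  "left_ann a = {x. x * a = 0}"

inductive_set ideal_gen :: "'a::ring_1 set \<Rightarrow> 'a set" for S where
  zero: "0 \<in> ideal_gen S"
| gen: "s \<in> S \<Longrightarrow> r * s * t \<in> ideal_gen S"
| add: "x \<in> ideal_gen S \<Longrightarrow> y \<in> ideal_gen S \<Longrightarrow> x + y \<in> ideal_gen S"

text \<open>Finitely generated projective right modules, realised (up to isomorphism) as direct
summands of the free module R^n, where R^n is the set of functions nat => R vanishing
from index n on; the right action is pointwise right multiplication.\<close>

definition free_mod :: "nat \<Rightarrow> (nat \<Rightarrow> 'a::ring_1) set" where
  "free_mod n = {v. \<forall>i\<ge>n. v i = 0}"

definition submod :: "nat \<Rightarrow> (nat \<Rightarrow> 'a::ring_1) set \<Rightarrow> bool" where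
  "submod n A \<longleftrightarrow> A \<subseteq> free_mod n \<and> (\<lambda>_. 0) \<in> A \<and>
     (\<forall>v\<in>A. \<forall>w\<in>A. (\<lambda>i. v i + w i) \<in> A) \<and>
     (\<forall>v\<in>A. \<forall>r. (\<lambda>i. v i * r) \<in> A)"

definition fg_projective :: "nat \<Rightarrow> (nat \<Rightarrow> 'a::ring_1) set \<Rightarrow> bool" where
  "fg_projective n A \<longleftrightarrow> submod n A \<and>
     (\<exists>C. submod n C \<and> A \<inter> C = {\<lambda>_. 0} \<and>
          (\<forall>v\<in>free_mod n. \<exists>a\<in>A. \<exists>c\<in>C. v = (\<lambda>i. a i + c i)))"

definition mod_iso :: "(nat \<Rightarrow> 'a::ring_1) set \<Rightarrow> (nat \<Rightarrow> 'a) set \<Rightarrow> bool" where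
  "mod_iso A B \<longleftrightarrow> (\<exists>f. bij_betw f A B \<and>
     (\<forall>v\<in>A. \<forall>w\<in>A. f (\<lambda>i. v i + w i) = (\<lambda>i. f v i + f w i)) \<and>
     (\<forall>v\<in>A. \<forall>r. f (\<lambda>i. v i * r) = (\<lambda>i. f v i * r)))"

definition dsum :: "nat \<Rightarrow> (nat \<Rightarrow> 'a::ring_1) set \<Rightarrow> (nat \<Rightarrow> 'a) set \<Rightarrow> (nat \<Rightarrow> 'a) set" where
  "dsum n A B = {(\<lambda>i. if i < n then a i else b (i - n)) | a b. a \<in> A \<and> b \<in> B}"

definition separative :: "'a::ring_1 itself \<Rightarrow> bool" where
  "separative _ \<longleftrightarrow>
     (\<forall>n m (A::(nat \<Rightarrow> 'a) set) B. fg_projective n A \<longrightarrow> fg_projective m B \<longrightarrow>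
        mod_iso (dsum n A A) (dsum n A B) \<longrightarrow> mod_iso (dsum n A B) (dsum m B B) \<longrightarrow>
        mod_iso A B)"

end

theory Submission
  imports Defs
begin

text \<open>
Put \<open>b = 1 - a\<^sup>2\<close> and \<open>f = ab = a - a\<^sup>3\<close>. Since \<open>a\<close> and \<open>b\<close> are comaximal and commute, regularity of
\<open>f\<close> passes to \<open>a\<close> and to \<open>b\<close>; let \<open>a'\<close> be a reflexive inverse of \<open>a\<close>, and let \<open>K = r(a)\<close> and
\<open>C = (1 - aa')R\<close>, the kernel and the cokernel of left multiplication by \<open>a\<close>. All of
\<open>K, C, bR, fR\<close> are generated by idempotents. Left multiplication by \<open>a\<close> maps \<open>bR\<close> onto \<open>fR\<close> with
kernel \<open>K\<close>, and left multiplication by \<open>1 - aa'\<close> maps \<open>bR\<close> onto \<open>C\<close> with kernel \<open>bR \<inter> aR = fR\<close>,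
so \<open>K \<oplus> fR \<cong> bR \<cong> C \<oplus> fR\<close>. As \<open>b\<close> lies in the trace ideals of both \<open>K\<close> and \<open>C\<close>, the module \<open>bR\<close>,
and with it \<open>fR\<close>, is a direct summand of some \<open>K\<^sup>n\<close> and of some \<open>C\<^sup>m\<close>. Separativity therefore allows
\<open>fR\<close> to be cancelled, and an isomorphism \<open>K \<cong> C\<close> extends \<open>a'\<close> to a unit inner inverse of \<open>a\<close>.
\<close>

section \<open>Cancellation in separative monoids\<close>

lemma sum_const_lessThan_add:
  fixes x :: "'m::comm_monoid_add" and k l :: nat
  shows "(\<Sum>i<k+l. x) = (\<Sum>i<k. x) + (\<Sum>i<l. x)"
  by (induction l) (simp_all add: ac_simps)

text \<open>The hypotheses read (n+1)x = nx + y and (n+1)y = ny + x. Descent on n ends at n = 1,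
  where they become 2x = x + y = 2y, which is separativity itself; at n = 0 they already say x =
  y.\<close>

lemma separative_eqI:
  fixes x y :: "'m::comm_monoid_add" and n :: nat
  assumes sep: "\<And>x y :: 'm. x + x = x + y \<Longrightarrow> x + y = y + y \<Longrightarrow> x = y"
    and "(\<Sum>i<n. x) + x = (\<Sum>i<n. x) + y" "(\<Sum>i<n. y) + y = (\<Sum>i<n. y) + x"
  shows "x = y"
  using assms(2,3)
proof (induction n)
  case 0
  then show ?case by simp
next
  case (Suc n)
  show ?case
  proof (cases n)
    case 0
    then have "x + x = x + y" "y + y = y + x" using Suc.prems by simp_all
    then show ?thesis by (metis sep add.commute)
  next
    case (Suc k)
    \<comment> \<open>Separativity applied to the pair \<open>(n + 1) u\<close> and \<open>n u + v\<close> lowers \<open>n\<close> by one.\<close>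
    have step: "(\<Sum>i<n. u) + u = (\<Sum>i<n. u) + v"
      if *: "(\<Sum>i<Suc n. u) + u = (\<Sum>i<Suc n. u) + v" for u v :: 'm
    proof (rule sep)
      define s where "s = (\<Sum>i<k. u)"
      have n: "(\<Sum>i<n. u) = s + u" using Suc by (simp add: s_def)
      \<comment> \<open>With X = s + u + u and Y = s + u + v, both X + Y and Y + Y contain the
        left-hand side of \<open>3\<close> as a summand. Trading that v for a u turns them into X +
        X and X + Y.\<close>
      have 3: "s + u + u + v = s + u + u + u" using * n by (simp add: ac_simps)
      have "(s + u + u) + (s + u + v) = (s + u) + (s + u + u + v)" by (simp add: ac_simps)
      also have "\<dots> = (s + u + u) + (s + u + u)" unfolding 3 by (simp add: ac_simps)
      finally have eq: "(s + u + u) + (s + u + v) = (s + u + u) + (s + u + u)" .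
      show "((\<Sum>i<n. u) + u) + ((\<Sum>i<n. u) + u) = ((\<Sum>i<n. u) + u) + ((\<Sum>i<n. u) + v)"
        unfolding n using eq by simp
      have "(s + u + v) + (s + u + v) = s + v + (s + u + u + v)" by (simp add: ac_simps)
      also have "\<dots> = (s + u + u) + (s + u + v)" unfolding 3 by (simp add: ac_simps)
      finally show "((\<Sum>i<n. u) + u) + ((\<Sum>i<n. u) + v) = ((\<Sum>i<n. u) + v) + ((\<Sum>i<n. u) + v)"
        unfolding n by simp
    qed
    show ?thesis using Suc.IH step Suc.prems by blast
  qed
qed

text \<open>Since c is a summand of kx, adding the rest of kx to x + c = y + c gives kx + x = kx +
  y, and similarly ly + y = ly + x. The common multiple k + l lets \<open>separative_eqI\<close> use
  both equations with the same n.\<close>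

lemma separative_cancel:
  fixes x y c :: "'m::comm_monoid_add" and k l :: nat
  assumes sep: "\<And>x y :: 'm. x + x = x + y \<Longrightarrow> x + y = y + y \<Longrightarrow> x = y"
    and eq: "x + c = y + c"
    and x: "c + d = (\<Sum>i<k. x)" and y: "c + e = (\<Sum>i<l. y)"
  shows "x = y"
proof (rule separative_eqI[OF sep])
  have "x + (\<Sum>i<k+l. x) = (x + c) + (d + (\<Sum>i<l. x))"
    by (simp add: sum_const_lessThan_add x[symmetric] ac_simps)
  also have "\<dots> = y + (\<Sum>i<k+l. x)"
    unfolding eq by (simp add: sum_const_lessThan_add x[symmetric] ac_simps)
  finally show "(\<Sum>i<k+l. x) + x = (\<Sum>i<k+l. x) + y" by (simp add: ac_simps)
  have "y + (\<Sum>i<k+l. y) = (y + c) + (e + (\<Sum>i<k. y))"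
    by (simp add: sum_const_lessThan_add y[symmetric] ac_simps)
  also have "\<dots> = x + (\<Sum>i<k+l. y)"
    unfolding eq[symmetric] by (simp add: sum_const_lessThan_add y[symmetric] ac_simps)
  finally show "(\<Sum>i<k+l. y) + y = (\<Sum>i<k+l. y) + x" by (simp add: ac_simps)
qed

section \<open>Homomorphisms and direct sums\<close>

definition mod_hom :: "(nat \<Rightarrow> 'a::ring_1) set \<Rightarrow> (nat \<Rightarrow> 'a) set \<Rightarrow> ((nat \<Rightarrow> 'a) \<Rightarrow> nat \<Rightarrow> 'a) \<Rightarrow> bool" where
  "mod_hom A B f \<longleftrightarrow> (\<forall>v\<in>A. f v \<in> B) \<and>
     (\<forall>v\<in>A. \<forall>w\<in>A. f (\<lambda>i. v i + w i) = (\<lambda>i. f v i + f w i)) \<and>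
     (\<forall>v\<in>A. \<forall>r. f (\<lambda>i. v i * r) = (\<lambda>i. f v i * r))"

lemma mod_homD:
  assumes "mod_hom A B f"
  shows "v \<in> A \<Longrightarrow> f v \<in> B"
    and "v \<in> A \<Longrightarrow> w \<in> A \<Longrightarrow> f (\<lambda>i. v i + w i) = (\<lambda>i. f v i + f w i)"
    and "v \<in> A \<Longrightarrow> f (\<lambda>i. v i * r) = (\<lambda>i. f v i * r)"
  using assms by (auto simp: mod_hom_def)

lemma submodD:
  assumes "submod n A"
  shows "A \<subseteq> free_mod n" "(\<lambda>_. 0) \<in> A"
    and "v \<in> A \<Longrightarrow> w \<in> A \<Longrightarrow> (\<lambda>i. v i + w i) \<in> A"
    and "v \<in> A \<Longrightarrow> (\<lambda>i. v i * r) \<in> A"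
  using assms by (auto simp: submod_def)

lemma submod_diff:
  assumes "submod n A" "v \<in> A" "w \<in> A"
  shows "(\<lambda>i. v i - w i) \<in> A"
proof -
  have "(\<lambda>i. v i + w i * (- 1)) \<in> A"
    using assms submodD(3,4) by blast
  then show ?thesis by simp
qed

lemma mod_hom_zero:
  assumes "mod_hom A B f" "(\<lambda>_. 0) \<in> A"
  shows "f (\<lambda>_. 0) = (\<lambda>_. 0)"
  using mod_homD(3)[OF assms, of 0] by simp

lemma mod_hom_diff:
  assumes "submod n A" "mod_hom A B f" "v \<in> A" "w \<in> A"
  shows "f (\<lambda>i. v i - w i) = (\<lambda>i. f v i - f w i)"
proof -
  have "f (\<lambda>i. v i + w i * r) = (\<lambda>i. f v i + f w i * r)" for r
    using mod_homD(2)[OF assms(2,3), of "\<lambda>i. w i * r"] mod_homD(3)[OF assms(2,4)]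
      submodD(4)[OF assms(1,4)] by simp
  from this[of "- 1"] show ?thesis by simp
qed

lemma mod_isoI:
  assumes "mod_hom A B f" "mod_hom B A g"
    and "\<And>v. v \<in> A \<Longrightarrow> g (f v) = v" "\<And>w. w \<in> B \<Longrightarrow> f (g w) = w"
  shows "mod_iso A B"
  unfolding mod_iso_def
  by (rule exI[of _ f])
    (use assms in \<open>auto simp: mod_hom_def intro: bij_betw_byWitness[where f' = g]\<close>)

text \<open>The inverse of a linear bijection is linear: sums and multiples of preimages stay in A,
  which is where \<open>submod n A\<close> enters.\<close>

lemma mod_isoE:
  assumes "submod n A" "mod_iso A B"
  obtains f g where "mod_hom A B f" "mod_hom B A g"
    "\<And>v. v \<in> A \<Longrightarrow> g (f v) = v" "\<And>w. w \<in> B \<Longrightarrow> f (g w) = w"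
proof -
  obtain f where f: "bij_betw f A B"
    "\<And>v w. v \<in> A \<Longrightarrow> w \<in> A \<Longrightarrow> f (\<lambda>i. v i + w i) = (\<lambda>i. f v i + f w i)"
    "\<And>v r. v \<in> A \<Longrightarrow> f (\<lambda>i. v i * r) = (\<lambda>i. f v i * r)"
    using assms(2) unfolding mod_iso_def by blast
  define g where "g = the_inv_into A f"
  have inj: "inj_on f A" and im: "f ` A = B" using f(1) by (auto simp: bij_betw_def)
  have gf: "g (f v) = v" if "v \<in> A" for v
    using that inj by (simp add: g_def the_inv_into_f_f)
  have fg: "f (g w) = w" and gA: "g w \<in> A" if "w \<in> B" for w
    using that gf im by force+
  show ?thesis
  proof (rule that[of f g])
    show "mod_hom A B f" using f im by (auto simp: mod_hom_def)
    show "mod_hom B A g"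
      unfolding mod_hom_def
    proof (intro conjI ballI allI)
      fix v w assume *: "v \<in> B" "w \<in> B"
      have "g (f (\<lambda>i. g v i + g w i)) = (\<lambda>i. g v i + g w i)"
        using * gA by (intro gf submodD(3)[OF assms(1)]) auto
      then show "g (\<lambda>i. v i + w i) = (\<lambda>i. g v i + g w i)"
        using * by (simp add: f(2) gA fg)
    next
      fix v r assume *: "v \<in> B"
      have "g (f (\<lambda>i. g v i * r)) = (\<lambda>i. g v i * r)"
        using * gA by (intro gf submodD(4)[OF assms(1)]) auto
      then show "g (\<lambda>i. v i * r) = (\<lambda>i. g v i * r)"
        using * by (simp add: f(3) gA fg)
    qed (rule gA)
  qed (use gf fg in auto)
qed

lemma mod_hom_comp:
  "mod_hom A B f \<Longrightarrow> mod_hom B C g \<Longrightarrow> mod_hom A C (\<lambda>v. g (f v))"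
  by (auto simp: mod_hom_def)

lemma mod_iso_refl: "mod_iso A A"
  by (rule mod_isoI[of _ _ "\<lambda>v. v" "\<lambda>v. v"]) (auto simp: mod_hom_def)

lemma mod_iso_sym:
  assumes "submod n A" "mod_iso A B"
  shows "mod_iso B A"
  using assms by (auto elim!: mod_isoE intro: mod_isoI)

lemma mod_iso_trans:
  assumes "submod n A" "submod m B" "mod_iso A B" "mod_iso B C"
  shows "mod_iso A C"
proof -
  obtain f f' where f: "mod_hom A B f" "mod_hom B A f'"
    "\<And>v. v \<in> A \<Longrightarrow> f' (f v) = v" "\<And>w. w \<in> B \<Longrightarrow> f (f' w) = w"
    using mod_isoE[OF assms(1,3)] by blast
  obtain g g' where g: "mod_hom B C g" "mod_hom C B g'"
    "\<And>v. v \<in> B \<Longrightarrow> g' (g v) = v" "\<And>w. w \<in> C \<Longrightarrow> g (g' w) = w"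
    using mod_isoE[OF assms(2,4)] by blast
  show ?thesis
    by (rule mod_isoI[OF mod_hom_comp[OF f(1) g(1)] mod_hom_comp[OF g(2) f(2)]])
      (use f g mod_homD(1) in \<open>metis+\<close>)
qed

section \<open>Concatenation of vectors and the calculus of direct sums\<close>

definition vjoin :: "nat \<Rightarrow> (nat \<Rightarrow> 'a) \<Rightarrow> (nat \<Rightarrow> 'a) \<Rightarrow> nat \<Rightarrow> 'a" where
  "vjoin n v w = (\<lambda>i. if i < n then v i else w (i - n))"

definition vtake :: "nat \<Rightarrow> (nat \<Rightarrow> 'a::ring_1) \<Rightarrow> nat \<Rightarrow> 'a" where
  "vtake n v = (\<lambda>i. if i < n then v i else 0)"

definition vdrop :: "nat \<Rightarrow> (nat \<Rightarrow> 'a) \<Rightarrow> nat \<Rightarrow> 'a" where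
  "vdrop n v = (\<lambda>i. v (i + n))"

lemma vjoin_vtake_vdrop [simp]: "vjoin n (vtake n v) (vdrop n v) = v"
  by (auto simp: vjoin_def vtake_def vdrop_def fun_eq_iff)

lemma vdrop_vjoin [simp]: "vdrop n (vjoin n v w) = w"
  by (auto simp: vjoin_def vdrop_def fun_eq_iff)

lemma vtake_vjoin: "v \<in> free_mod n \<Longrightarrow> vtake n (vjoin n v w) = v"
  by (auto simp: vjoin_def vtake_def free_mod_def fun_eq_iff)

lemma vec_add:
  "vjoin n (\<lambda>i. v i + v' i) (\<lambda>i. w i + w' i) = (\<lambda>i. vjoin n v w i + vjoin n v' w' i)"
  "vtake n (\<lambda>i. v i + v' i) = (\<lambda>i. vtake n v i + vtake n v' i)"
  "vdrop n (\<lambda>i. x i + x' i) = (\<lambda>i. vdrop n x i + vdrop n x' i)"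
  by (auto simp: vjoin_def vtake_def vdrop_def)

lemma vec_scale:
  "vjoin n (\<lambda>i. v i * r) (\<lambda>i. w i * r) = (\<lambda>i. vjoin n v w i * r)"
  "vtake n (\<lambda>i. v i * r) = (\<lambda>i. vtake n v i * r)"
  "vdrop n (\<lambda>i. x i * r) = (\<lambda>i. vdrop n x i * r)"
  by (auto simp: vjoin_def vtake_def vdrop_def)

lemma vec_zero:
  "vjoin n (\<lambda>_. 0) (\<lambda>_. 0) = (\<lambda>_. 0)" "vtake n (\<lambda>_. 0) = (\<lambda>_. 0)" "vdrop n (\<lambda>_. 0) = (\<lambda>_. 0)"
  by (auto simp: vjoin_def vtake_def vdrop_def)

lemma vjoin_assoc: "vjoin (n + m) (vjoin n u v) w = vjoin n u (vjoin m v w)"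
  by (auto simp: vjoin_def fun_eq_iff)

lemma dsum_vjoin: "dsum n A B = {vjoin n v w | v w. v \<in> A \<and> w \<in> B}"
  by (simp add: dsum_def vjoin_def)

text \<open>Elements of A vanish from index n on, so truncation recovers the left component. This
  replaces the existential description of \<open>dsum\<close> by membership of the two
  blocks.\<close>

lemma dsum_iff:
  assumes "A \<subseteq> free_mod n"
  shows "x \<in> dsum n A B \<longleftrightarrow> vtake n x \<in> A \<and> vdrop n x \<in> B"
proof
  assume "x \<in> dsum n A B"
  then show "vtake n x \<in> A \<and> vdrop n x \<in> B"
    using assms by (auto simp: dsum_vjoin vtake_vjoin)
next
  assume "vtake n x \<in> A \<and> vdrop n x \<in> B"
  then show "x \<in> dsum n A B"
    unfolding dsum_vjoin using vjoin_vtake_vdrop[of n x] by (metis (mono_tags, lifting) mem_Collect_eq)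
qed

text \<open>Concatenation is strictly associative, so this is an equality of sets and not merely an
  isomorphism.\<close>

lemma dsum_assoc: "dsum (n + m) (dsum n A B) C = dsum n A (dsum m B C)"
  unfolding dsum_vjoin by (auto simp: vjoin_assoc) (metis vjoin_assoc)+

lemma free_mod_0: "free_mod 0 = {\<lambda>_. 0}"
  by (auto simp: free_mod_def)

lemma dsum_zero: "dsum 0 {\<lambda>_. 0} A = A"
  by (auto simp: dsum_def)

lemma vtake_free_mod: "vtake n x \<in> free_mod n"
  by (simp add: vtake_def free_mod_def)

lemma vdrop_free_mod: "x \<in> free_mod (n + m) \<Longrightarrow> vdrop n x \<in> free_mod m"
  by (simp add: vdrop_def free_mod_def)

lemma vjoin_free_mod: "w \<in> free_mod m \<Longrightarrow> vjoin n v w \<in> free_mod (n + m)"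
  by (auto simp: vjoin_def free_mod_def)

lemma submod_dsum:
  assumes "submod n A" "submod m B"
  shows "submod (n + m) (dsum n A B)"
proof -
  have "x \<in> free_mod (n + m)" if "x \<in> dsum n A B" for x
    using that submodD(1)[OF assms(2)] by (auto simp: dsum_vjoin intro!: vjoin_free_mod)
  then show ?thesis
    using submodD(2-4)[OF assms(1)] submodD(2-4)[OF assms(2)]
    by (auto simp: submod_def dsum_iff[OF submodD(1)[OF assms(1)]] vec_add vec_scale vec_zero)
qed

lemma fg_projective_submod: "fg_projective n A \<Longrightarrow> submod n A"
  by (simp add: fg_projective_def)

text \<open>Complements add up: \<open>dsum n C D\<close> complements \<open>dsum n A B\<close>, as
  is checked block by block.\<close>

lemma fg_projective_dsum:
  assumes "fg_projective n A" "fg_projective m B"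
  shows "fg_projective (n + m) (dsum n A B)"
proof -
  obtain C where C: "submod n C" "A \<inter> C = {\<lambda>_. 0}"
    "\<And>v. v \<in> free_mod n \<Longrightarrow> \<exists>a\<in>A. \<exists>c\<in>C. v = (\<lambda>i. a i + c i)"
    using assms(1) unfolding fg_projective_def by blast
  obtain D where D: "submod m D" "B \<inter> D = {\<lambda>_. 0}"
    "\<And>v. v \<in> free_mod m \<Longrightarrow> \<exists>b\<in>B. \<exists>d\<in>D. v = (\<lambda>i. b i + d i)"
    using assms(2) unfolding fg_projective_def by blast
  have A: "submod n A" and B: "submod m B"
    using assms by (simp_all add: fg_projective_submod)
  note iff = dsum_iff[OF submodD(1)[OF A]] dsum_iff[OF submodD(1)[OF C(1)]]
  show ?thesis
    unfolding fg_projective_def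
  proof (intro conjI exI[of _ "dsum n C D"] submod_dsum A B C(1) D(1) ballI)
    show "dsum n A B \<inter> dsum n C D = {\<lambda>_. 0}"
    proof (intro equalityI subsetI)
      fix x assume "x \<in> dsum n A B \<inter> dsum n C D"
      then have "vtake n x \<in> A \<inter> C" "vdrop n x \<in> B \<inter> D" by (auto simp: iff)
      then have "vtake n x = (\<lambda>_. 0)" "vdrop n x = (\<lambda>_. 0)" using C(2) D(2) by auto
      then show "x \<in> {\<lambda>_. 0}"
        using vjoin_vtake_vdrop[of n x] by (simp add: vec_zero)
    next
      fix x :: "nat \<Rightarrow> 'a" assume "x \<in> {\<lambda>_. 0}"
      then show "x \<in> dsum n A B \<inter> dsum n C D"
        using submodD(2)[OF A] submodD(2)[OF B] submodD(2)[OF C(1)] submodD(2)[OF D(1)]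
        by (simp add: iff vec_zero)
    qed
  next
    fix x :: "nat \<Rightarrow> 'a" assume x: "x \<in> free_mod (n + m)"
    obtain a c where ac: "a \<in> A" "c \<in> C" "vtake n x = (\<lambda>i. a i + c i)"
      using C(3)[OF vtake_free_mod] by blast
    obtain b d where bd: "b \<in> B" "d \<in> D" "vdrop n x = (\<lambda>i. b i + d i)"
      using D(3)[OF vdrop_free_mod[OF x]] by blast
    have "x = vjoin n (\<lambda>i. a i + c i) (\<lambda>i. b i + d i)"
      using vjoin_vtake_vdrop[of n x] ac(3) bd(3) by simp
    then have "x = (\<lambda>i. vjoin n a b i + vjoin n c d i)" by (simp add: vec_add)
    moreover have "vjoin n a b \<in> dsum n A B" "vjoin n c d \<in> dsum n C D"
      using ac bd by (auto simp: dsum_vjoin)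
    ultimately show "\<exists>u\<in>dsum n A B. \<exists>w\<in>dsum n C D. x = (\<lambda>i. u i + w i)" by blast
  qed
qed

lemma mod_hom_dsum:
  assumes "A \<subseteq> free_mod n" "A' \<subseteq> free_mod n'" "mod_hom A A' f" "mod_hom B B' g"
  shows "mod_hom (dsum n A B) (dsum n' A' B') (\<lambda>x. vjoin n' (f (vtake n x)) (g (vdrop n x)))"
  using mod_homD[OF assms(3)] mod_homD[OF assms(4)] assms(2)
  by (auto simp: mod_hom_def dsum_iff[OF assms(1)] dsum_iff[OF assms(2)]
      vec_add vec_scale vtake_vjoin subset_iff)

lemma mod_iso_dsum:
  assumes "submod n A" "submod n' A'" "submod m B"
    and "mod_iso A A'" "mod_iso B B'"
  shows "mod_iso (dsum n A B) (dsum n' A' B')"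
proof -
  obtain f f' where f: "mod_hom A A' f" "mod_hom A' A f'"
    "\<And>v. v \<in> A \<Longrightarrow> f' (f v) = v" "\<And>w. w \<in> A' \<Longrightarrow> f (f' w) = w"
    using mod_isoE[OF assms(1,4)] by blast
  obtain g g' where g: "mod_hom B B' g" "mod_hom B' B g'"
    "\<And>v. v \<in> B \<Longrightarrow> g' (g v) = v" "\<And>w. w \<in> B' \<Longrightarrow> g (g' w) = w"
    using mod_isoE[OF assms(3,5)] by blast
  have A: "A \<subseteq> free_mod n" and A': "A' \<subseteq> free_mod n'"
    using assms by (simp_all add: submodD(1))
  have "vtake n' (vjoin n' (f (vtake n x)) w) = f (vtake n x)" if "vtake n x \<in> A" for x w
    using mod_homD(1)[OF f(1) that] A' by (auto intro: vtake_vjoin)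
  moreover have "vtake n (vjoin n (f' (vtake n' x)) w) = f' (vtake n' x)" if "vtake n' x \<in> A'" for x w
    using mod_homD(1)[OF f(2) that] A by (auto intro: vtake_vjoin)
  ultimately show ?thesis
    by (intro mod_isoI[OF mod_hom_dsum[OF A A' f(1) g(1)] mod_hom_dsum[OF A' A f(2) g(2)]])
      (simp_all add: dsum_iff[OF A] dsum_iff[OF A'] f g)
qed

lemma mod_iso_dsum_comm:
  assumes A: "A \<subseteq> free_mod n" and B: "B \<subseteq> free_mod m"
  shows "mod_iso (dsum n A B) (dsum m B A)"
proof (rule mod_isoI[of _ _ "\<lambda>x. vjoin m (vdrop n x) (vtake n x)" "\<lambda>x. vjoin n (vdrop m x) (vtake m x)"])
qed (use assms in \<open>auto simp: mod_hom_def dsum_iff[OF A] dsum_iff[OF B] vtake_vjoin subset_iff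
      vec_add vec_scale\<close>)

section \<open>The monoid of isomorphism classes of projectives\<close>

text \<open>A pair is related to itself exactly when it is a finitely generated projective module,
  so the partial quotient is the monoid V(R). The length is kept with the module because
  \<open>dsum\<close> needs it for its left operand.\<close>

definition fgp_iso :: "nat \<times> (nat \<Rightarrow> 'a::ring_1) set \<Rightarrow> nat \<times> (nat \<Rightarrow> 'a) set \<Rightarrow> bool" where
  "fgp_iso P Q \<longleftrightarrow> fg_projective (fst P) (snd P) \<and> fg_projective (fst Q) (snd Q) \<and> mod_iso (snd P) (snd Q)"

lemma fg_projective_zero: "fg_projective 0 {\<lambda>_. 0 :: 'a::ring_1}"
  unfolding fg_projective_def
  by (intro conjI exI[of _ "{\<lambda>_. 0}"]) (auto simp: submod_def free_mod_0)

quotient_type (overloaded) 'a fgp_class = "nat \<times> (nat \<Rightarrow> 'a::ring_1) set" / partial: fgp_iso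
proof (rule part_equivpI)
  have "fgp_iso (0, {\<lambda>_. 0 :: 'a}) (0, {\<lambda>_. 0})"
    by (simp add: fgp_iso_def fg_projective_zero mod_iso_refl)
  then show "\<exists>P :: nat \<times> (nat \<Rightarrow> 'a) set. fgp_iso P P" ..
  show "symp (fgp_iso :: _ \<Rightarrow> nat \<times> (nat \<Rightarrow> 'a) set \<Rightarrow> bool)"
    by (auto simp: symp_def fgp_iso_def dest: mod_iso_sym[OF fg_projective_submod])
  show "transp (fgp_iso :: _ \<Rightarrow> nat \<times> (nat \<Rightarrow> 'a) set \<Rightarrow> bool)"
    by (auto simp: transp_def fgp_iso_def
        dest: mod_iso_trans[OF fg_projective_submod fg_projective_submod])
qed

instantiation fgp_class :: (ring_1) comm_monoid_add
begin

lift_definition zero_fgp_class :: "'a fgp_class" is "(0, {\<lambda>_. 0})"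
  by (simp add: fgp_iso_def fg_projective_zero mod_iso_refl)

lift_definition plus_fgp_class :: "'a fgp_class \<Rightarrow> 'a fgp_class \<Rightarrow> 'a fgp_class"
  is "\<lambda>P Q. (fst P + fst Q, dsum (fst P) (snd P) (snd Q))"
  by (auto simp: fgp_iso_def fg_projective_dsum intro!: mod_iso_dsum fg_projective_submod)

instance
proof
  fix x y z :: "'a fgp_class"
  show "x + y + z = x + (y + z)"
    by transfer (auto simp: fgp_iso_def fg_projective_dsum dsum_assoc mod_iso_refl
        fg_projective_dsum[of _ _ "_ + _", simplified add.assoc] add.assoc)
  show "x + y = y + x"
    by transfer (auto simp: fgp_iso_def fg_projective_dsum
        intro!: mod_iso_dsum_comm submodD(1) fg_projective_submod)
  show "0 + x = x"
    by transfer (auto simp: fgp_iso_def dsum_zero)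
qed

end

definition cls :: "nat \<Rightarrow> (nat \<Rightarrow> 'a::ring_1) set \<Rightarrow> 'a fgp_class" where
  "cls n A = abs_fgp_class (n, A)"

lemma fgp_iso_refl: "fg_projective n A \<Longrightarrow> fgp_iso (n, A) (n, A)"
  by (simp add: fgp_iso_def mod_iso_refl)

lemma cls_cases:
  obtains n A where "fg_projective n A" "x = cls n A"
proof (rule that[of "fst (rep_fgp_class x)" "snd (rep_fgp_class x)"])
  show "x = cls (fst (rep_fgp_class x)) (snd (rep_fgp_class x))"
    using Quotient_abs_rep[OF Quotient_fgp_class, of x] by (simp add: cls_def)
  show "fg_projective (fst (rep_fgp_class x)) (snd (rep_fgp_class x))"
    using Quotient_rep_reflp[OF Quotient_fgp_class, of x] by (simp add: fgp_iso_def)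
qed

lemma cls_eq_iff:
  assumes "fg_projective n A" "fg_projective m B"
  shows "cls n A = cls m B \<longleftrightarrow> mod_iso A B"
  using Quotient_rel[OF Quotient_fgp_class, of "(n, A)" "(m, B)"] assms
  by (auto simp: cls_def fgp_iso_def mod_iso_refl)

lemma cls_add:
  assumes "fg_projective n A" "fg_projective m B"
  shows "cls n A + cls m B = cls (n + m) (dsum n A B)"
  using assms by (simp add: cls_def plus_fgp_class.abs_eq fgp_iso_refl eq_onp_same_args)

lemma cls_zero: "0 = cls 0 {\<lambda>_. 0}"
  by (simp add: cls_def zero_fgp_class_def)

text \<open>Separativity of the ring is separativity of the monoid V(R), once every class is
  represented by an actual module.\<close>

lemma separative_fgp_class:
  assumes "separative TYPE('a::ring_1)" "x + x = x + y" "x + y = y + y"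
  shows "x = (y :: 'a fgp_class)"
proof -
  obtain n A where A: "fg_projective n A" "x = cls n A" by (rule cls_cases)
  obtain m B where B: "fg_projective m B" "y = cls m B" by (rule cls_cases)
  have "mod_iso (dsum n A A) (dsum n A B)" "mod_iso (dsum n A B) (dsum m B B)"
    using assms(2,3) A B by (simp_all add: cls_add cls_eq_iff fg_projective_dsum)
  then have "mod_iso A B"
    using assms(1) A(1) B(1) unfolding separative_def by blast
  then show ?thesis using A B by (simp add: cls_eq_iff)
qed


text \<open>The composite of \<open>g\<close> followed by \<open>f\<close> is an idempotent
  endomorphism of B with image f(A), a copy of A, and kernel Y. Hence B is the direct sum of f(A)
  and Y.\<close>

lemma retract_complement:
  assumes A: "fg_projective n A" and B: "fg_projective m B"
    and f: "mod_hom A B f" and g: "mod_hom B A g" and gf: "\<And>v. v \<in> A \<Longrightarrow> g (f v) = v"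
  defines "Y \<equiv> {w \<in> B. g w = (\<lambda>_. 0)}"
  shows "fg_projective m Y" and "cls n A + cls m Y = cls m B"
proof -
  obtain C where C: "submod m C" "B \<inter> C = {\<lambda>_. 0}"
    "\<And>v. v \<in> free_mod m \<Longrightarrow> \<exists>b\<in>B. \<exists>c\<in>C. v = (\<lambda>i. b i + c i)"
    using B unfolding fg_projective_def by blast
  have sA: "submod n A" and sB: "submod m B" using A B by (simp_all add: fg_projective_submod)
  note A' = submodD[OF sA] and B' = submodD[OF sB] and C' = submodD[OF C(1)]
  have f0: "f (\<lambda>_. 0) = (\<lambda>_. 0)" and g0: "g (\<lambda>_. 0) = (\<lambda>_. 0)"
    using f g A'(2) B'(2) mod_hom_zero by blast+
  have sY: "submod m Y"
    using B' mod_homD[OF g] by (auto simp: submod_def Y_def g0)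
  have proj: "(\<lambda>i. b i - f (g b) i) \<in> Y" if "b \<in> B" for b
  proof -
    have "f (g b) \<in> B" using that mod_homD(1)[OF f] mod_homD(1)[OF g] by blast
    then show ?thesis
      using that mod_homD(1)[OF g that] submod_diff[OF sB that] mod_hom_diff[OF sB g that]
      by (simp add: Y_def gf)
  qed
  \<comment> \<open>B splits into f(A) and Y, and C complements B, so f(A) + C is a complement of Y
    in the free module.\<close>
  define D where "D = {(\<lambda>i. f a i + c i) | a c. a \<in> A \<and> c \<in> C}"
  have DI: "(\<lambda>i. f a i + c i) \<in> D" if "a \<in> A" "c \<in> C" for a c
    using that by (auto simp: D_def)
  have sD: "submod m D"
    unfolding submod_def
  proof (intro conjI ballI allI subsetI)
    fix v assume "v \<in> D"
    then obtain a c where v: "a \<in> A" "c \<in> C" "v = (\<lambda>i. f a i + c i)" by (auto simp: D_def)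
    have "f a \<in> free_mod m" "c \<in> free_mod m"
      using v mod_homD(1)[OF f] B'(1) C'(1) by auto
    then show "v \<in> free_mod m" by (simp add: v free_mod_def)
    fix r
    show "(\<lambda>i. v i * r) \<in> D"
      using DI[OF A'(4)[OF v(1)] C'(4)[OF v(2)], of r r] mod_homD(3)[OF f v(1)]
      by (simp add: v distrib_right)
    fix w assume "w \<in> D"
    then obtain a' c' where w: "a' \<in> A" "c' \<in> C" "w = (\<lambda>i. f a' i + c' i)" by (auto simp: D_def)
    show "(\<lambda>i. v i + w i) \<in> D"
      using DI[OF A'(3)[OF v(1) w(1)] C'(3)[OF v(2) w(2)]] mod_homD(2)[OF f v(1) w(1)]
      by (simp add: v w ac_simps)
  next
    show "(\<lambda>_. 0) \<in> D" using DI[OF A'(2) C'(2)] by (simp add: f0)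
  qed
  show Y: "fg_projective m Y"
    unfolding fg_projective_def
  proof (intro conjI exI[of _ D] sY sD ballI)
    show "Y \<inter> D = {\<lambda>_. 0}"
    proof (intro equalityI subsetI)
      fix v assume v: "v \<in> Y \<inter> D"
      then obtain a c where ac: "a \<in> A" "c \<in> C" "v = (\<lambda>i. f a i + c i)" by (auto simp: D_def)
      have "f a \<in> B" "v \<in> B" using ac v mod_homD(1)[OF f] by (auto simp: Y_def)
      from submod_diff[OF sB this(2,1)] have "c \<in> B" by (simp add: ac)
      with C(2) ac(2) have "c = (\<lambda>_. 0)" by blast
      with ac have "v = f a" by simp
      with v have "g (f a) = (\<lambda>_. 0)" by (simp add: Y_def)
      with ac(1) \<open>v = f a\<close> show "v \<in> {\<lambda>_. 0}" by (simp add: gf f0)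
    qed (use submodD(2)[OF sY] submodD(2)[OF sD] in auto)
  next
    fix v :: "nat \<Rightarrow> 'a" assume "v \<in> free_mod m"
    then obtain b c where bc: "b \<in> B" "c \<in> C" "v = (\<lambda>i. b i + c i)" using C(3) by blast
    have "v = (\<lambda>i. (b i - f (g b) i) + (f (g b) i + c i))" by (simp add: bc)
    then show "\<exists>y\<in>Y. \<exists>d\<in>D. v = (\<lambda>i. y i + d i)"
      using proj[OF bc(1)] DI[OF mod_homD(1)[OF g bc(1)] bc(2)] by (intro bexI)
  qed
  have "mod_iso (dsum n A Y) B"
  proof (rule mod_isoI[of _ _ "\<lambda>x i. f (vtake n x) i + vdrop n x i"
        "\<lambda>b. vjoin n (g b) (\<lambda>i. b i - f (g b) i)"])
    note iff = dsum_iff[OF A'(1)]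
    show "mod_hom (dsum n A Y) B (\<lambda>x i. f (vtake n x) i + vdrop n x i)"
      using mod_homD[OF f] B'(3)
      by (auto simp: mod_hom_def iff vec_add vec_scale Y_def distrib_right ac_simps)
    show "mod_hom B (dsum n A Y) (\<lambda>b. vjoin n (g b) (\<lambda>i. b i - f (g b) i))"
      unfolding mod_hom_def
    proof (intro conjI ballI allI)
      fix b assume b: "b \<in> B"
      then show "vjoin n (g b) (\<lambda>i. b i - f (g b) i) \<in> dsum n A Y"
        using proj mod_homD(1)[OF g] by (auto simp: dsum_vjoin)
      show "vjoin n (g (\<lambda>i. b i * r)) (\<lambda>i. b i * r - f (g (\<lambda>i. b i * r)) i) =
          (\<lambda>i. vjoin n (g b) (\<lambda>i. b i - f (g b) i) i * r)" for r
        using b by (simp add: mod_homD[OF g] mod_homD[OF f] vec_scale[symmetric] left_diff_distrib)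
      fix c assume c: "c \<in> B"
      show "vjoin n (g (\<lambda>i. b i + c i)) (\<lambda>i. b i + c i - f (g (\<lambda>i. b i + c i)) i) =
          (\<lambda>i. vjoin n (g b) (\<lambda>i. b i - f (g b) i) i + vjoin n (g c) (\<lambda>i. c i - f (g c) i) i)"
        using b c by (simp add: mod_homD[OF g] mod_homD[OF f] vec_add[symmetric] algebra_simps)
    qed
  next
    fix x assume "x \<in> dsum n A Y"
    then have x: "vtake n x \<in> A" "vdrop n x \<in> B" "g (vdrop n x) = (\<lambda>_. 0)"
      by (auto simp: dsum_iff[OF A'(1)] Y_def)
    have "g (\<lambda>i. f (vtake n x) i + vdrop n x i) = vtake n x"
      using x mod_homD(1)[OF f] by (simp add: mod_homD(2)[OF g] gf)
    then show "vjoin n (g (\<lambda>i. f (vtake n x) i + vdrop n x i))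
        (\<lambda>i. f (vtake n x) i + vdrop n x i - f (g (\<lambda>i. f (vtake n x) i + vdrop n x i)) i) = x"
      by simp
  next
    fix b assume "b \<in> B"
    then have "g b \<in> free_mod n" using mod_homD(1)[OF g] A'(1) by blast
    then show "(\<lambda>i. f (vtake n (vjoin n (g b) (\<lambda>i. b i - f (g b) i))) i +
        vdrop n (vjoin n (g b) (\<lambda>i. b i - f (g b) i)) i) = b"
      by (simp add: vtake_vjoin)
  qed
  then show "cls n A + cls m Y = cls m B"
    using A B Y by (simp add: cls_add cls_eq_iff fg_projective_dsum)
qed

section \<open>Projectives given by idempotents\<close>

text \<open>For idempotent e this is (eR)^n, described by fixed vectors so that membership is an
  equation in each coordinate. The case n = 1 represents eR.\<close>

definition idem_mod :: "nat \<Rightarrow> 'a::ring_1 \<Rightarrow> (nat \<Rightarrow> 'a) set" where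
  "idem_mod n e = {v \<in> free_mod n. \<forall>i. e * v i = v i}"

lemma fg_projective_idem_mod:
  fixes e :: "'a::ring_1"
  assumes "e * e = e"
  shows "fg_projective n (idem_mod n e)"
proof -
  have sub: "submod n (idem_mod n c)" for c :: 'a
    by (auto simp: submod_def idem_mod_def free_mod_def distrib_left mult.assoc[symmetric])
  show ?thesis
    unfolding fg_projective_def
  proof (intro conjI exI[of _ "idem_mod n (1 - e)"] sub ballI)
    show "idem_mod n e \<inter> idem_mod n (1 - e) = {\<lambda>_. 0}"
      using submodD(2)[OF sub] by (auto simp: idem_mod_def left_diff_distrib)
    fix v :: "nat \<Rightarrow> 'a" assume "v \<in> free_mod n"
    then have "(\<lambda>i. e * v i) \<in> idem_mod n e" "(\<lambda>i. (1 - e) * v i) \<in> idem_mod n (1 - e)"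
      using assms by (auto simp: idem_mod_def free_mod_def mult.assoc[symmetric] algebra_simps)
    moreover have "v = (\<lambda>i. e * v i + (1 - e) * v i)" by (simp add: left_diff_distrib)
    ultimately show "\<exists>x\<in>idem_mod n e. \<exists>y\<in>idem_mod n (1 - e). v = (\<lambda>i. x i + y i)"
      by (intro bexI)
  qed
qed

abbreviation icls :: "'a::ring_1 \<Rightarrow> 'a fgp_class" where
  "icls e \<equiv> cls 1 (idem_mod 1 e)"

lemma idem_mod_0: "idem_mod 0 e = {\<lambda>_. 0}"
  by (auto simp: idem_mod_def free_mod_0)

lemma idem_mod_Suc: "idem_mod (Suc n) e = dsum n (idem_mod n e) (idem_mod 1 e)"
proof -
  have "idem_mod n e \<subseteq> free_mod n" by (auto simp: idem_mod_def)
  moreover have "x \<in> idem_mod (Suc n) e \<longleftrightarrow> vtake n x \<in> idem_mod n e \<and> vdrop n x \<in> idem_mod 1 e" for x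
  proof -
    have "(\<forall>i. e * x i = x i) \<longleftrightarrow>
        (\<forall>i. e * vtake n x i = vtake n x i) \<and> (\<forall>i. e * vdrop n x i = vdrop n x i)"
      by (auto simp: vtake_def vdrop_def) (metis add.commute le_add_diff_inverse not_le)
    moreover have "x \<in> free_mod (Suc n) \<longleftrightarrow> vdrop n x \<in> free_mod 1"
    proof
      assume *: "vdrop n x \<in> free_mod 1"
      have "x i = 0" if "i \<ge> Suc n" for i
        using that *[unfolded free_mod_def vdrop_def, simplified, rule_format, of "i - n"] by simp
      then show "x \<in> free_mod (Suc n)" by (simp add: free_mod_def)
    qed (simp add: free_mod_def vdrop_def)
    ultimately show ?thesis by (auto simp: idem_mod_def vtake_free_mod)
  qed
  ultimately show ?thesis using dsum_iff by blast
qed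

lemma cls_idem_mod:
  assumes "e * e = e"
  shows "cls n (idem_mod n e) = (\<Sum>i<n. icls e)"
proof (induction n)
  case 0
  show ?case by (simp add: idem_mod_0 cls_zero)
next
  case (Suc n)
  note fgp = fg_projective_idem_mod[OF assms]
  have "cls (Suc n) (idem_mod (Suc n) e) = cls n (idem_mod n e) + icls e"
    unfolding cls_add[OF fgp fgp] idem_mod_Suc[of n] by simp
  also have "\<dots> = (\<Sum>i<Suc n. icls e)" unfolding Suc by simp
  finally show ?case .
qed

text \<open>Left multiplication by t maps gR onto eR, with left multiplication by s as a section,
  and the elements fixed by k form its kernel. So gR splits into eR and this kernel.\<close>

lemma icls_split:
  fixes e g k s t :: "'a::ring_1"
  assumes "e * e = e" "g * g = g"
    and s: "g * s * e = s * e" and t: "e * t * g = t * g" and ts: "t * s * e = e"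
    and ker: "\<And>x. k * x = x \<longleftrightarrow> g * x = x \<and> t * x = 0"
  shows "icls e + icls k = icls g"
proof -
  have hom: "mod_hom (idem_mod 1 c) (idem_mod 1 d) (\<lambda>v i. z * v i)" if z: "d * z * c = z * c"
    for c d z :: 'a
  proof -
    have "d * (z * x) = z * x" if "c * x = x" for x
      using z that by (metis mult.assoc)
    then show ?thesis
      by (auto simp: mod_hom_def idem_mod_def free_mod_def distrib_left mult.assoc)
  qed
  have "t * (s * x) = x" if "e * x = x" for x
    using ts that by (metis mult.assoc)
  then have "(\<lambda>i. t * (s * v i)) = v" if "v \<in> idem_mod 1 e" for v
    using that by (auto simp: idem_mod_def)
  then have "icls e + cls 1 {w \<in> idem_mod 1 g. (\<lambda>i. t * w i) = (\<lambda>_. 0)} = icls g"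
    by (rule retract_complement(2)[OF fg_projective_idem_mod[OF assms(1)]
          fg_projective_idem_mod[OF assms(2)] hom[OF s] hom[OF t]])
  moreover have "{w \<in> idem_mod 1 g. (\<lambda>i. t * w i) = (\<lambda>_. 0)} = idem_mod 1 k"
    using ker by (auto simp: idem_mod_def fun_eq_iff)
  ultimately show ?thesis by simp
qed

section \<open>From membership in a trace ideal to direct summands of multiples\<close>

lemma ideal_gen_sum:
  assumes "x \<in> ideal_gen S" and S: "\<And>s. s \<in> S \<Longrightarrow> \<exists>c d. s = c * e * d"
  shows "\<exists>(n::nat) r u. x = (\<Sum>i<n. r i * e * u i)"
  using assms(1)
proof induction
  case zero
  show ?case by (rule exI[of _ 0]) simp
next
  case (gen s r t)
  obtain c d where "s = c * e * d" using S gen by blast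
  then have "r * s * t = (\<Sum>i<1::nat. (r * c) * e * (d * t))" by (simp add: mult.assoc)
  then show ?case
    by (rule_tac exI[of _ "1::nat"], rule_tac exI[of _ "\<lambda>_. r * c"], rule_tac exI[of _ "\<lambda>_. d * t"])
next
  case (add x y)
  then obtain n m :: nat and r u r' u'
    where x: "x = (\<Sum>i<n. r i * e * u i)" and y: "y = (\<Sum>i<m. r' i * e * u' i)" by blast
  have "(\<Sum>i<n+m. (if i < n then r i else r' (i - n)) * e * (if i < n then u i else u' (i - n)))
      = x + y"
    unfolding x y by (induction m) (simp_all add: add.assoc)
  then show ?case
    by (rule_tac exI[of _ "n + m"], rule_tac exI[of _ "\<lambda>i. if i < n then r i else r' (i - n)"],
        rule_tac exI[of _ "\<lambda>i. if i < n then u i else u' (i - n)"]) (rule sym)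
qed

text \<open>The module bR is a retract of (eR)^n: send v to the tuple of all
  \<open>e * u i * b' * v\<close>, and come back by \<open>b * b'\<close> times the sum of all
  \<open>r i * w i\<close>. The round trip is multiplication by \<open>b * b' * b * b'\<close>,
  which is the identity on bR.\<close>

lemma icls_le_multiple:
  assumes e: "e * e = e" and b: "b * b' * b = (b::'a::ring_1)"
    and "b = (\<Sum>i<n::nat. r i * e * u i)"
  shows "\<exists>c. icls (b * b') + c = (\<Sum>i<n. icls e)"
proof -
  have g: "b * b' * (b * b') = b * b'" using b by (simp add: mult.assoc[symmetric])
  define f where "f = (\<lambda>(v::nat \<Rightarrow> 'a) i. if i < n then e * u i * b' * v 0 else 0)"
  define h where "h = (\<lambda>(w::nat \<Rightarrow> 'a) i. if i = (0::nat) then b * b' * (\<Sum>i<n. r i * w i) else 0)"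
  have "e * (e * x) = e * x" for x using e by (metis mult.assoc)
  then have f: "mod_hom (idem_mod 1 (b * b')) (idem_mod n e) f"
    by (auto simp: mod_hom_def idem_mod_def free_mod_def f_def fun_eq_iff distrib_left mult.assoc)
  have "b * b' * (b * b' * x) = b * b' * x" for x using g by (metis mult.assoc)
  then have h: "mod_hom (idem_mod n e) (idem_mod 1 (b * b')) h"
    by (auto simp: mod_hom_def idem_mod_def free_mod_def h_def fun_eq_iff distrib_left
        sum.distrib sum_distrib_right mult.assoc)
  have "h (f v) = v" if "v \<in> idem_mod 1 (b * b')" for v
  proof -
    have v: "b * b' * v 0 = v 0" "\<And>i. i > 0 \<Longrightarrow> v i = 0"
      using that by (auto simp: idem_mod_def free_mod_def)
    have "(\<Sum>i<n. r i * f v i) = b * (b' * v 0)"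
      by (subst assms(3)) (simp add: f_def sum_distrib_right mult.assoc)
    then have "h (f v) 0 = v 0" using v(1) by (simp add: h_def mult.assoc)
    then show ?thesis using v(2) by (auto simp: h_def fun_eq_iff)
  qed
  from retract_complement(2)[OF fg_projective_idem_mod[OF g] fg_projective_idem_mod[OF e] f h this]
  show ?thesis unfolding cls_idem_mod[OF e, of n, symmetric] by (rule exI)
qed

text \<open>A homomorphism out of pR is left multiplication by the image of its generator p. Thus s
  and t are the images of p and q under an isomorphism pR -> qR and its inverse.\<close>

lemma icls_eqE:
  fixes p q :: "'a::ring_1"
  assumes p: "p * p = p" and q: "q * q = q" and "icls p = icls q"
  obtains s t where "q * s = s" "s * p = s" "p * t = t" "t * q = t" "t * s = p" "s * t = q"
proof -
  have "mod_iso (idem_mod 1 p) (idem_mod 1 q)"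
    using assms by (simp add: cls_eq_iff fg_projective_idem_mod)
  then obtain f g where f: "mod_hom (idem_mod 1 p) (idem_mod 1 q) f"
    and g: "mod_hom (idem_mod 1 q) (idem_mod 1 p) g"
    and gf: "\<And>v. v \<in> idem_mod 1 p \<Longrightarrow> g (f v) = v" and fg: "\<And>v. v \<in> idem_mod 1 q \<Longrightarrow> f (g v) = v"
    using mod_isoE fg_projective_submod[OF fg_projective_idem_mod[OF p]] by metis
  \<comment> \<open>\<open>\<delta>\<close> embeds R as the vectors of length 1; for an idempotent
    c, \<open>\<delta> c\<close> generates \<open>idem_mod 1 c\<close>.\<close>
  define \<delta> where "\<delta> = (\<lambda>c (i::nat). if i = 0 then c else (0::'a))"
  have \<delta>: "\<delta> c \<in> idem_mod 1 c" if "c * c = c" for c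
    using that by (auto simp: \<delta>_def idem_mod_def free_mod_def)
  have decomp: "v = (\<lambda>i. \<delta> c i * v 0)" "c * v 0 = v 0" if "v \<in> idem_mod 1 c" for v c
    using that by (auto simp: \<delta>_def idem_mod_def free_mod_def fun_eq_iff)
  define s where "s = f (\<delta> p) 0"
  define t where "t = g (\<delta> q) 0"
  have f': "f v 0 = s * v 0" if "v \<in> idem_mod 1 p" for v
    using arg_cong[OF decomp(1)[OF that], of f] mod_homD(3)[OF f \<delta>[OF p]] by (simp add: s_def)
  have g': "g v 0 = t * v 0" if "v \<in> idem_mod 1 q" for v
    using arg_cong[OF decomp(1)[OF that], of g] mod_homD(3)[OF g \<delta>[OF q]] by (simp add: t_def)
  have fp: "f (\<delta> p) \<in> idem_mod 1 q" and gq: "g (\<delta> q) \<in> idem_mod 1 p"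
    using mod_homD(1)[OF f \<delta>[OF p]] mod_homD(1)[OF g \<delta>[OF q]] .
  have 0: "\<delta> c 0 = c" for c by (simp add: \<delta>_def)
  show ?thesis
  proof (rule that)
    show "q * s = s" "p * t = t" using decomp(2) fp gq by (auto simp: s_def t_def)
    show "s * p = s" "t * q = t" using f'[OF \<delta>[OF p]] g'[OF \<delta>[OF q]] by (simp_all add: 0 s_def t_def)
    show "t * s = p" using g'[OF fp] gf[OF \<delta>[OF p]] by (simp add: 0 s_def)
    show "s * t = q" using f'[OF gq] fg[OF \<delta>[OF q]] by (simp add: 0 t_def)
  qed
qed

text \<open>The element a is invertible from a'aR to aa'R, and s supplies the missing isomorphism
  from its kernel pR to its cokernel qR. So a + s is a unit, and its inverse a' + t is still an
  inner inverse of a.\<close>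

lemma unit_regular_if_icls_eq:
  fixes a a' :: "'a::ring_1"
  assumes a: "a * a' * a = a" and a': "a' * a * a' = a'"
    and "icls (1 - a' * a) = icls (1 - a * a')"
  shows "unit_regular a"
proof -
  define p where "p = 1 - a' * a"
  define q where "q = 1 - a * a'"
  have ap: "a * p = 0" and qa: "q * a = 0" and pa: "p * a' = 0" and aq: "a' * q = 0"
    using a a' by (simp_all add: p_def q_def algebra_simps)
  have "p * p = p" "q * q = q"
    using a a' by (simp_all add: p_def q_def left_diff_distrib right_diff_distrib mult.assoc[symmetric])
  moreover have "icls p = icls q" unfolding p_def q_def by (rule assms(3))
  ultimately obtain s t where st: "q * s = s" "s * p = s" "p * t = t" "t * q = t" "t * s = p" "s * t = q"
    by (rule icls_eqE)
  \<comment> \<open>The cross terms pass through a zero product: at = apt, sa' = spa', a's = a'qs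
    and ta = tqa.\<close>
  have "a * t = 0" "s * a' = 0" "a' * s = 0" "t * a = 0"
    using arg_cong[OF st(3), of "(*) a"] arg_cong[OF st(2), of "\<lambda>x. x * a'"]
      arg_cong[OF st(1), of "(*) a'"] arg_cong[OF st(4), of "\<lambda>x. x * a"]
    by (simp_all add: ap pa aq qa mult.assoc[symmetric]) (simp_all add: pa qa mult.assoc)
  then have "(a' + t) * (a + s) = 1" "(a + s) * (a' + t) = 1" "a * (a' + t) * a = a"
    using st a by (simp_all add: algebra_simps p_def q_def)
  then show ?thesis unfolding unit_regular_def ring_unit_def by metis
qed

theorem theorem2p3:
  fixes a :: "'a::ring_1"
  assumes "separative TYPE('a)"
    and "exchange_ring TYPE('a)"
    and "ring_unit (2::'a)"
    and "regular (a - a ^ 3)"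
    and "ideal_gen {1 - a ^ 2} = ideal_gen (right_ann a)"
    and "ideal_gen (right_ann a) = ideal_gen (left_ann a)"
  shows "unit_regular a"
proof -
  define b where "b = 1 - a * a"
  define f where "f = a * b"
  have ab: "a * b = b * a" by (simp add: b_def algebra_simps)
  then have ab_left: "a * (b * x) = b * (a * x)" for x by (metis mult.assoc)
  have f3: "a - a ^ 3 = f" by (simp add: f_def b_def algebra_simps power3_eq_cube)
  obtain y where y: "f * y * f = f" using assms(4) unfolding regular_def f3 by metis
  have f_cancel: "f * (y * (f * x)) = f * x" for x using y by (metis mult.assoc)
  \<comment> \<open>Because a and b commute, the second summand contributes fyf = f, and a^3 + f =
    a. So a + byb is an inner inverse of a.\<close>
  have "a * (a + b * y * b) * a = a * a * a + f * y * f"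
    by (simp add: f_def distrib_left distrib_right mult.assoc ab ab_left)
  also have "\<dots> = a" unfolding y by (simp add: f_def b_def algebra_simps)
  finally obtain z where z: "a * z * a = a" by blast
  \<comment> \<open>Replacing an inner inverse z by zaz makes it reflexive.\<close>
  define a' where "a' = z * a * z"
  have a: "a * a' * a = a" and a': "a' * a * a' = a'"
    unfolding a'_def using z by (metis mult.assoc)+
  have a_cancel: "a * (a' * (a * x)) = a * x" for x using a by (metis mult.assoc)
  \<comment> \<open>Chosen so that bb'b = b^2 + fyfa = b^2 + fa = b(b + a^2), where b + a^2 =
    1.\<close>
  define b' where "b' = 1 + a * y * a * a"
  have b: "b * b' * b = b"
  proof -
    have "a * (a * b) = f * a" by (simp add: f_def ab ab_left mult.assoc)
    then have "b * b' * b = b * b + f * (y * (f * a))"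
      by (simp add: b'_def f_def ab ab_left distrib_left distrib_right mult.assoc)
    also have "\<dots> = b * (b + a * a)"
      unfolding f_cancel by (simp add: f_def ab distrib_left mult.assoc)
    finally show ?thesis by (simp add: b_def)
  qed
  have b_cancel: "b * (b' * (b * x)) = b * x" for x using b by (metis mult.assoc)
  \<comment> \<open>The idempotents p, q, g, h generate K, C, bR and fR respectively.\<close>
  define p where "p = 1 - a' * a"
  define q where "q = 1 - a * a'"
  define g where "g = b * b'"
  define h where "h = f * y"
  have idem: "p * p = p" "q * q = q" "g * g = g" "h * h = h"
    by (simp_all add: p_def q_def g_def h_def algebra_simps
        a[unfolded mult.assoc] a'[unfolded mult.assoc] b_cancel f_cancel)
  have ap: "a * p = 0" and qa: "q * a = 0"
    using a by (simp_all add: p_def q_def algebra_simps)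
  have p_iff: "p * x = x \<longleftrightarrow> a * x = 0" for x
    using a_cancel[of x] by (auto simp: p_def algebra_simps)
  have q_iff: "q * x = 0 \<longleftrightarrow> a * (a' * x) = x" for x
    by (auto simp: q_def algebra_simps)
  \<comment> \<open>Left multiplication by a maps bR onto fR, and by is a section because a(by) = h.
    The kernel is all of r(a): if ax = 0 then x = bx lies in bR.\<close>
  have hp: "icls h + icls p = icls g"
  proof (rule icls_split[where s = "b * y" and t = a])
    show "g * (b * y) * h = b * y * h" by (simp add: g_def b_cancel mult.assoc)
    show "h * a * g = a * g"
      using f_cancel[of b'] by (simp add: f_def g_def h_def mult.assoc)
    show "a * (b * y) * h = h"
      using f_cancel[of y] by (simp add: f_def h_def mult.assoc)
    have "g * x = x" if "a * x = 0" for x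
    proof -
      have "b * x = x" using that by (simp add: b_def algebra_simps)
      then show ?thesis using b_cancel[of x] by (simp add: g_def mult.assoc)
    qed
    then show "p * x = x \<longleftrightarrow> g * x = x \<and> a * x = 0" for x by (auto simp: p_iff)
  qed (use idem in simp_all)
  \<comment> \<open>Here qa = 0 gives qb = q, so left multiplication by b is a section of left
    multiplication by q from bR to C.\<close>
  have qh: "icls q + icls h = icls g"
  proof (rule icls_split[where s = b and t = q])
    show "g * b * q = b * q" by (simp add: g_def b_cancel mult.assoc)
    show "q * q * g = q * g" by (simp add: idem)
    have "q * b = q" by (simp add: b_def right_diff_distrib mult.assoc[symmetric] qa)
    then show "q * b * q = q" by (simp add: idem)
    show "h * x = x \<longleftrightarrow> g * x = x \<and> q * x = 0" for x
    proof
      assume "h * x = x"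
      then have 1: "x = a * (b * (y * x))" "x = b * (a * (y * x))"
        by (simp_all add: h_def f_def mult.assoc ab_left)
      have "g * x = x" by (subst (1 2) 1(2)) (simp add: g_def b_cancel mult.assoc)
      moreover have "q * x = 0" by (subst 1(1)) (simp add: mult.assoc[symmetric] qa)
      ultimately show "g * x = x \<and> q * x = 0" ..
    next
      assume x: "g * x = x \<and> q * x = 0"
      \<comment> \<open>Comaximality shows that bR and aR meet in fR: insert x = aa'x into the first
        summand and x = bb'x into the second, and both become right multiples of f.\<close>
      have "x = b * x + a * (a * x)" by (simp add: b_def algebra_simps)
      also have "b * x = f * (a' * x)"
        using x q_iff[of x] by (simp add: f_def ab_left mult.assoc)
      also have "a * (a * x) = f * (a * (b' * x))"
        using x by (simp add: g_def f_def ab_left[symmetric] mult.assoc)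
      finally have "x = f * (a' * x + a * (b' * x))" by (simp add: distrib_left)
      then show "h * x = x" unfolding h_def by (metis f_cancel mult.assoc)
    qed
  qed (use idem in simp_all)
  have "b \<in> ideal_gen {1 - a ^ 2}"
    using ideal_gen.gen[of "1 - a ^ 2" "{1 - a ^ 2}" 1 1] by (simp add: b_def power2_eq_square)
  then have bR: "b \<in> ideal_gen (right_ann a)" and bL: "b \<in> ideal_gen (left_ann a)"
    using assms(5,6) by simp_all
  \<comment> \<open>Every s in r(a) equals ps, and every s in l(a) equals sq. So b is a finite sum
    of terms rpu, and also one of terms rqu.\<close>
  have "\<exists>c d. s = c * p * d" if "s \<in> right_ann a" for s
    using that p_iff[of s] by (intro exI[of _ 1] exI[of _ s]) (simp add: right_ann_def)
  from ideal_gen_sum[OF bR this] obtain k d where d: "icls g + d = (\<Sum>i<k::nat. icls p)"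
    unfolding g_def by (metis icls_le_multiple[OF idem(1) b])
  have "s * q = s" if "s * a = 0" for s
    using that by (simp add: q_def right_diff_distrib mult.assoc[symmetric])
  then have "\<exists>c d. s = c * q * d" if "s \<in> left_ann a" for s
    using that by (intro exI[of _ s] exI[of _ 1]) (simp add: left_ann_def)
  from ideal_gen_sum[OF bL this] obtain l e where e: "icls g + e = (\<Sum>i<l::nat. icls q)"
    unfolding g_def by (metis icls_le_multiple[OF idem(2) b])
  have "icls p = icls q"
  proof (rule separative_cancel[OF separative_fgp_class[OF assms(1)]])
    show "icls p + icls h = icls q + icls h" using hp qh by (simp add: ac_simps)
    \<comment> \<open>The complement of fR in K^k consists of K, its complement in bR, and of d, the
      complement of bR in K^k.\<close>
    show "icls h + (icls p + d) = (\<Sum>i<k. icls p)" using hp d by (simp add: ac_simps)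
    show "icls h + (icls q + e) = (\<Sum>i<l. icls q)" using qh e by (simp add: ac_simps)
  qed
  then show ?thesis using unit_regular_if_icls_eq[OF a a'] by (simp add: p_def q_def)
qed

end
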